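(* Let $\mathcal{X}$ be a finite set, let $\pi$ be a probability measure on $\mathcal{X}$ with strictly positive masses, let $P\in\mathcal{L}(\pi)$, and let $\mathcal{X}=\bigsqcup_{i=1}^k\mathcal{O}_i$ be a partition into non-empty sets, with associated Gibbs kernel $G$ and projection chain $\overline{P}$. Then for every $l\in\mathbb{N}$, $$\|(GPG)^l-\Pi\|_{F,\pi}^2=\mathrm{Tr}\left((GPG)^{2l}\right)-1=\mathrm{Tr}\left(\overline{P}^{2l}\right)-\mathrm{Tr}(\overline{\Pi})=\left\|\overline{P}^l-\overline{\Pi}\right\|_{F,\overline{\pi}}^2.$$
   Context: $\mathbb{N}=\{1,2,\dots\}$. $\mathcal{L}(\pi)$ is the set of $\pi$-reversible transition matrices on $\mathcal{X}$. The Gibbs kernel is $G(x,y)=\pi(y)/\pi(\mathcal{O}(x))$ if $y\in\mathcal{O}(x)$ and $0$ otherwise, where $\mathcal{O}(x)$ is the block containing $x$ and $\pi(A)=\sum_{z\in A}\pi(z)$. $\Pi$ is the matrix all of whose rows equal $\pi$. The projection chain is the $k\times k$ transition matrix $\overline{P}(i,j)=\frac{1}{\pi(\mathcal{O}_i)}\sum_{x\in\mathcal{O}_i,\,y\in\mathcal{O}_j}\pi(x)P(x,y)$, with stationary distribution $\overline{\pi}=(\pi(\mathcal{O}_1),\dots,\pi(\mathcal{O}_k))$; $\overline{\Pi}$ is the $k\times k$ matrix all of whose rows equal $\overline{\pi}$. For a strictly positive probability measure $\mu$ on a finite set and a real square matrix $M$ indexed by that set, $M^*(x,y)=\frac{\mu(y)}{\mu(x)}M(y,x)$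 is the $\ell^2(\mu)$-adjoint and $\|M\|_{F,\mu}^2=\mathrm{Tr}(M^*M)$. *)

theory Defs
  imports "HOL-Analysis.Analysis"
begin

text \<open>
  A finite set is represented by a finite type, and a real square matrix indexed by it by
  \<^typ>\<open>real^'n^'n\<close>, where \<open>M $ x $ y\<close> is the entry \<open>M(x,y)\<close>: first index row, second column.
\<close>

definition positive_prob :: "real^'n \<Rightarrow> bool" where
  "positive_prob \<mu> \<longleftrightarrow> (\<forall>x. \<mu> $ x > 0) \<and> (\<Sum>x\<in>UNIV. \<mu> $ x) = 1"

definition mass :: "real^'n \<Rightarrow> 'n set \<Rightarrow> real" where
  "mass \<mu> A = (\<Sum>z\<in>A. \<mu> $ z)"

definition transition_matrix :: "real^'n^'n \<Rightarrow> bool" where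
  "transition_matrix P \<longleftrightarrow> (\<forall>x y. P $ x $ y \<ge> 0) \<and> (\<forall>x. (\<Sum>y\<in>UNIV. P $ x $ y) = 1)"

definition reversible_kernels :: "real^'n \<Rightarrow> (real^'n^'n) set" where
  "reversible_kernels \<mu> =
     {P. transition_matrix P \<and> (\<forall>x y. \<mu> $ x * P $ x $ y = \<mu> $ y * P $ y $ x)}"

text \<open>
  The \<open>k\<close> blocks are indexed by a finite type, whose cardinality is \<open>k\<close>. Non-emptiness and
  disjointness make the indexing injective.
\<close>

definition is_partition :: "('k \<Rightarrow> 'n set) \<Rightarrow> bool" where
  "is_partition B \<longleftrightarrow> disjoint_family B \<and> (\<Union>i. B i) = UNIV \<and> (\<forall>i. B i \<noteq> {})"

definition block_of :: "('k \<Rightarrow> 'n set) \<Rightarrow> 'n \<Rightarrow> 'n set" where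
  "block_of B x = B (THE i. x \<in> B i)"

definition gibbs_kernel :: "real^'n \<Rightarrow> ('k \<Rightarrow> 'n set) \<Rightarrow> real^'n^'n" where
  "gibbs_kernel \<mu> B =
     (\<chi> x y. if y \<in> block_of B x then \<mu> $ y / mass \<mu> (block_of B x) else 0)"

definition constant_rows :: "real^'n \<Rightarrow> real^'n^'n" where
  "constant_rows \<mu> = (\<chi> x y. \<mu> $ y)"

definition projection_chain :: "real^'n \<Rightarrow> ('k \<Rightarrow> 'n set) \<Rightarrow> real^'n^'n \<Rightarrow> real^'k^'k" where
  "projection_chain \<mu> B P =
     (\<chi> i j. 1 / mass \<mu> (B i) * (\<Sum>x\<in>B i. \<Sum>y\<in>B j. \<mu> $ x * P $ x $ y))"

definition projected_measure :: "real^'n \<Rightarrow> ('k \<Rightarrow> 'n set) \<Rightarrow> real^'k" where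
  "projected_measure \<mu> B = (\<chi> i. mass \<mu> (B i))"

text \<open>
  The library's \<open>M ^ l\<close> and \<open>M * N\<close> on \<^typ>\<open>real^'n^'n\<close> are componentwise, so powers for the
  matrix product \<open>**\<close> need their own definition.
\<close>

primrec matrix_pow :: "real^'n^'n \<Rightarrow> nat \<Rightarrow> real^'n^'n" where
  "matrix_pow M 0 = mat 1"
| "matrix_pow M (Suc l) = M ** matrix_pow M l"

text \<open>
  The adjoint of \<open>M\<close> in \<open>\<ell>\<^sup>2(\<mu>)\<close>; the library's \<^const>\<open>adjoint\<close> and \<^const>\<open>transpose\<close> are
  relative to the unweighted inner product.
\<close>

definition weighted_adjoint :: "real^'n \<Rightarrow> real^'n^'n \<Rightarrow> real^'n^'n" where
  "weighted_adjoint \<mu> M = (\<chi> x y. \<mu> $ y / \<mu> $ x * M $ y $ x)"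

definition frobenius_norm :: "real^'n \<Rightarrow> real^'n^'n \<Rightarrow> real" where
  "frobenius_norm \<mu> M = sqrt (trace (weighted_adjoint \<mu> M ** M))"

end

theory Submission
  imports Defs
begin

text \<open>
  The Gibbs kernel factors as \<open>G = A C\<close>, where \<open>A\<close> is the membership matrix of the blocks and row
  \<open>i\<close> of \<open>C\<close> is \<open>\<pi>\<close> conditioned on block \<open>i\<close>. Then \<open>C A = I\<close> and \<open>C P A\<close> is the projection chain,
  so \<open>(G P G)\<^sup>m = A (C P A)\<^sup>m C\<close> for \<open>m \<ge> 1\<close>, and cyclicity of the trace gives the middle equality.
  The outer two are instances of one identity: if \<open>M\<close> is self-adjoint with \<open>M \<Pi> = \<Pi>\<close>, then
  \<open>N = M\<^sup>l\<close> satisfies \<open>(N - \<Pi>)\<^sup>* (N - \<Pi>) = N\<^sup>2 - \<Pi>\<close>.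
\<close>

section \<open>Matrix algebra and the weighted adjoint\<close>

lemma matrix_sub_ldistrib:
  fixes M N K :: "real^'a::finite^'a"
  shows "M ** (N - K) = M ** N - M ** K"
  by (simp add: matrix_matrix_mult_def vec_eq_iff right_diff_distrib sum_subtractf)

lemma matrix_sub_rdistrib:
  fixes M N K :: "real^'a::finite^'a"
  shows "(N - K) ** M = N ** M - K ** M"
  by (simp add: matrix_matrix_mult_def vec_eq_iff left_diff_distrib sum_subtractf)

lemma matrix_pow_add:
  fixes M :: "real^'a::finite^'a"
  shows "matrix_pow M (m + n) = matrix_pow M m ** matrix_pow M n"
  by (induction m) (simp_all add: matrix_mul_assoc)

text \<open>The weights telescope along the summation index: \<open>\<mu> $ y / \<mu> $ x\<close>
  splits as \<open>\<mu> $ y / \<mu> $ z\<close> times \<open>\<mu> $ z / \<mu> $ x\<close>.\<close>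

lemma weighted_adjoint_mul:
  fixes M N :: "real^'a::finite^'a"
  assumes "positive_prob \<mu>"
  shows "weighted_adjoint \<mu> (M ** N) = weighted_adjoint \<mu> N ** weighted_adjoint \<mu> M"
proof -
  have "\<mu> $ x \<noteq> 0" for x
    using assms by (metis positive_prob_def less_irrefl)
  then show ?thesis
    by (simp add: weighted_adjoint_def matrix_matrix_mult_def vec_eq_iff sum_distrib_left
        mult.commute mult.left_commute)
qed

lemma weighted_adjoint_mat_1:
  fixes \<mu> :: "real^'a::finite"
  assumes "positive_prob \<mu>"
  shows "weighted_adjoint \<mu> (mat 1) = mat 1"
proof -
  have "\<mu> $ x \<noteq> 0" for x
    using assms by (metis positive_prob_def less_irrefl)
  then show ?thesis
    by (auto simp: weighted_adjoint_def mat_def vec_eq_iff)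
qed

lemma weighted_adjoint_diff:
  "weighted_adjoint \<mu> (M - N) = weighted_adjoint \<mu> M - weighted_adjoint \<mu> N"
  by (simp add: weighted_adjoint_def vec_eq_iff right_diff_distrib)

lemma weighted_adjoint_constant_rows:
  assumes "positive_prob \<mu>"
  shows "weighted_adjoint \<mu> (constant_rows \<mu>) = constant_rows \<mu>"
proof -
  have "\<mu> $ x \<noteq> 0" for x
    using assms by (metis positive_prob_def less_irrefl)
  then show ?thesis
    by (simp add: weighted_adjoint_def constant_rows_def vec_eq_iff)
qed

text \<open>Clearing the denominator \<open>\<mu> $ x\<close> turns self-adjointness into detailed
  balance, so reversibility becomes an algebraic condition stable under powers.\<close>

lemma weighted_adjoint_self_iff:
  assumes "positive_prob \<mu>"
  shows "weighted_adjoint \<mu> M = M \<longleftrightarrow> (\<forall>x y. \<mu> $ x * M $ x $ y = \<mu> $ y * M $ y $ x)"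
proof -
  have "\<mu> $ y / \<mu> $ x * M $ y $ x = M $ x $ y \<longleftrightarrow> \<mu> $ x * M $ x $ y = \<mu> $ y * M $ y $ x"
    for x y
  proof -
    have "\<mu> $ x \<noteq> 0"
      using assms by (metis positive_prob_def less_irrefl)
    then show ?thesis
      by (auto simp: nonzero_divide_eq_eq nonzero_eq_divide_eq mult.commute)
  qed
  then show ?thesis
    by (simp add: weighted_adjoint_def vec_eq_iff)
qed

lemma weighted_adjoint_matrix_pow:
  fixes M :: "real^'a::finite^'a"
  assumes "positive_prob \<mu>" and "weighted_adjoint \<mu> M = M"
  shows "weighted_adjoint \<mu> (matrix_pow M l) = matrix_pow M l"
proof (induction l)
  case 0
  show ?case using assms(1) by (simp add: weighted_adjoint_mat_1)
next
  case (Suc l)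
  \<comment> \<open>Taking adjoints reverses the product and leaves \<open>M\<close> on the right,
    whereas \<open>matrix_pow\<close> unfolds on the left.\<close>
  have "matrix_pow M l ** M = matrix_pow M (l + 1)"
    by (simp only: matrix_pow_add) simp
  then show ?case
    using Suc by (simp add: weighted_adjoint_mul assms)
qed

lemma matrix_pow_fixes:
  fixes M K :: "real^'a::finite^'a"
  assumes "M ** K = K"
  shows "matrix_pow M l ** K = K"
  by (induction l) (simp_all add: assms matrix_mul_assoc[symmetric])

text \<open>Entry \<open>(x, y)\<close> of the product is the sum of row \<open>x\<close> times
  \<open>\<mu> $ y\<close>, and the positive factor cancels. The row-sum condition thus becomes a
  matrix equation that passes to products.\<close>

lemma mul_constant_rows_eq_iff:
  fixes M :: "real^'a::finite^'a"
  assumes "positive_prob \<mu>"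
  shows "M ** constant_rows \<mu> = constant_rows \<mu> \<longleftrightarrow> (\<forall>x. (\<Sum>y\<in>UNIV. M $ x $ y) = 1)"
proof -
  have "\<mu> $ x \<noteq> 0" for x
    using assms by (metis positive_prob_def less_irrefl)
  then show ?thesis
    by (simp add: matrix_matrix_mult_def constant_rows_def vec_eq_iff
        flip: sum_distrib_right)
qed

section \<open>Frobenius norm of a centred power\<close>

lemma trace_constant_rows:
  assumes "positive_prob \<mu>"
  shows "trace (constant_rows \<mu>) = 1"
  using assms by (simp add: trace_def constant_rows_def positive_prob_def)

text \<open>Squaring undoes the square root because the trace is a sum of squares with positive
  weights.\<close>

lemma frobenius_norm_power2:
  fixes M :: "real^'a::finite^'a"
  assumes "positive_prob \<mu>"
  shows "(frobenius_norm \<mu> M)\<^sup>2 = trace (weighted_adjoint \<mu> M ** M)"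
proof -
  have "\<mu> $ y / \<mu> $ x * (M $ y $ x * M $ y $ x) \<ge> 0" for x y
    using assms
    by (intro mult_nonneg_nonneg[OF divide_nonneg_pos] zero_le_square)
      (simp_all add: positive_prob_def less_imp_le)
  then have "trace (weighted_adjoint \<mu> M ** M) \<ge> 0"
    by (simp add: trace_def matrix_matrix_mult_def weighted_adjoint_def mult.assoc sum_nonneg)
  then show ?thesis
    by (simp add: frobenius_norm_def)
qed

lemma frobenius_norm_matrix_pow_diff_constant_rows:
  fixes M :: "real^'a::finite^'a"
  assumes \<mu>: "positive_prob \<mu>"
    and adj: "weighted_adjoint \<mu> M = M"
    and fix_rows: "M ** constant_rows \<mu> = constant_rows \<mu>"
  shows "(frobenius_norm \<mu> (matrix_pow M l - constant_rows \<mu>))\<^sup>2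
           = trace (matrix_pow M (2 * l)) - 1"
proof -
  define N where "N = matrix_pow M l"
  define K where "K = constant_rows \<mu>"
  have N: "weighted_adjoint \<mu> N = N"
    unfolding N_def using \<mu> adj by (rule weighted_adjoint_matrix_pow)
  have K: "weighted_adjoint \<mu> K = K"
    unfolding K_def using \<mu> by (rule weighted_adjoint_constant_rows)
  have NK: "N ** K = K"
    unfolding N_def K_def using fix_rows by (rule matrix_pow_fixes)
  \<comment> \<open>This is the adjoint of \<open>NK\<close>, both factors being
    self-adjoint.\<close>
  have KN: "K ** N = K"
    using weighted_adjoint_mul[OF \<mu>, of N K] by (simp add: N K NK)
  have KK: "K ** K = K"
    unfolding K_def mul_constant_rows_eq_iff[OF \<mu>]
    using \<mu> by (simp add: constant_rows_def positive_prob_def)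
  have "weighted_adjoint \<mu> (N - K) ** (N - K) = N ** N - K"
    by (simp add: weighted_adjoint_diff N K matrix_sub_ldistrib matrix_sub_rdistrib NK KN KK)
  moreover have "N ** N = matrix_pow M (2 * l)"
    unfolding N_def mult_2 matrix_pow_add ..
  ultimately show ?thesis
    using frobenius_norm_power2[OF \<mu>, of "N - K"] trace_constant_rows[OF \<mu>]
    by (simp add: N_def K_def trace_sub)
qed

section \<open>Factorization of the Gibbs kernel and the projection chain\<close>

definition membership_matrix :: "('k::finite \<Rightarrow> 'n::finite set) \<Rightarrow> real^'k^'n" where
  "membership_matrix B = (\<chi> x i. indicator (B i) x)"

text \<open>As an operator on functions this averages over each block, while
  \<open>membership_matrix\<close> lifts a function of blocks to one of points.\<close>

definition conditional_matrix :: "real^'n::finite \<Rightarrow> ('k::finite \<Rightarrow> 'n set) \<Rightarrow> real^'n^'k" where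
  "conditional_matrix \<mu> B = (\<chi> i y. indicator (B i) y * \<mu> $ y / mass \<mu> (B i))"

context
  fixes \<mu> :: "real^'n::finite" and B :: "'k::finite \<Rightarrow> 'n set"
  assumes \<mu>: "positive_prob \<mu>" and B: "is_partition B"
begin

lemma mem_block_iff:
  assumes "x \<in> B i"
  shows "x \<in> B j \<longleftrightarrow> j = i"
  using B assms by (auto simp: is_partition_def disjoint_family_on_def)

lemma obtain_block:
  obtains i where "x \<in> B i"
  using B by (auto simp: is_partition_def)

lemma block_of_eq:
  assumes "x \<in> B i"
  shows "block_of B x = B i"
  by (simp add: block_of_def mem_block_iff[OF assms])

lemma mass_pos: "mass \<mu> (B i) > 0"
  unfolding mass_def
  using \<mu> B by (intro sum_pos) (auto simp: positive_prob_def is_partition_def)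

lemma positive_prob_projected_measure: "positive_prob (projected_measure \<mu> B)"
proof -
  have "(\<Sum>i\<in>UNIV. mass \<mu> (B i)) = (\<Sum>x\<in>(\<Union>i. B i). \<mu> $ x)"
    unfolding mass_def using B
    by (subst sum.UNION_disjoint) (auto simp: is_partition_def disjoint_family_on_def)
  then show ?thesis
    using \<mu> B mass_pos by (simp add: positive_prob_def projected_measure_def is_partition_def)
qed

lemma gibbs_kernel_factorization:
  "gibbs_kernel \<mu> B = membership_matrix B ** conditional_matrix \<mu> B"
proof -
  have "gibbs_kernel \<mu> B $ x $ y = (membership_matrix B ** conditional_matrix \<mu> B) $ x $ y" for x y
  proof -
    obtain i where i: "x \<in> B i"
      by (rule obtain_block)
    \<comment> \<open>Only the block containing \<open>x\<close> contributes, so the sum over blocks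
      collapses to the index \<open>i\<close>.\<close>
    have "(membership_matrix B ** conditional_matrix \<mu> B) $ x $ y
        = (\<Sum>j\<in>UNIV. if j = i then indicator (B j) y * \<mu> $ y / mass \<mu> (B j) else 0)"
      unfolding matrix_matrix_mult_def membership_matrix_def conditional_matrix_def vec_lambda_beta
      by (intro sum.cong) (auto simp: mem_block_iff[OF i])
    also have "\<dots> = gibbs_kernel \<mu> B $ x $ y"
      by (simp add: gibbs_kernel_def block_of_eq[OF i])
    finally show ?thesis ..
  qed
  then show ?thesis
    by (simp add: vec_eq_iff)
qed

text \<open>Entry \<open>(i, j)\<close> is the conditional probability of block \<open>j\<close>
  given block \<open>i\<close>, which disjointness makes 0 or 1.\<close>

lemma conditional_mul_membership: "conditional_matrix \<mu> B ** membership_matrix B = mat 1"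
proof -
  have "(\<Sum>y\<in>UNIV. indicator (B i) y * \<mu> $ y / mass \<mu> (B i) * indicator (B j) y)
      = (if i = j then 1 else 0)" for i j
  proof -
    have "(\<Sum>y\<in>UNIV. indicator (B i) y * \<mu> $ y / mass \<mu> (B i) * indicator (B j) y)
        = (\<Sum>y\<in>UNIV. indicator (B i \<inter> B j) y * \<mu> $ y) / mass \<mu> (B i)"
      unfolding sum_divide_distrib by (intro sum.cong) (auto simp: indicator_def)
    also have "\<dots> = mass \<mu> (B i \<inter> B j) / mass \<mu> (B i)"
      by (simp only: Indicator_Function.sum_indicator_mult[OF finite] Int_UNIV_left mass_def)
    also have "\<dots> = (if i = j then 1 else 0)"
      using B mass_pos[of i]
      by (auto simp: is_partition_def disjoint_family_on_def mass_def)
    finally show ?thesis .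
  qed
  then show ?thesis
    by (simp add: matrix_matrix_mult_def membership_matrix_def conditional_matrix_def mat_def
        vec_eq_iff)
qed

lemma projection_chain_factorization:
  "projection_chain \<mu> B P = conditional_matrix \<mu> B ** P ** membership_matrix B"
proof -
  have "(conditional_matrix \<mu> B ** P ** membership_matrix B) $ i $ j
      = projection_chain \<mu> B P $ i $ j" for i j
  proof -
    \<comment> \<open>The product associates to the left, so the outer sum runs over the column
      index \<open>y\<close> of \<open>P\<close>; the order is exchanged afterwards.\<close>
    have "(conditional_matrix \<mu> B ** P ** membership_matrix B) $ i $ j
        = (\<Sum>y\<in>UNIV. \<Sum>x\<in>UNIV. indicator (B j) y * (indicator (B i) x *
            (\<mu> $ x * P $ x $ y / mass \<mu> (B i))))"
      by (simp add: matrix_matrix_mult_def membership_matrix_def conditional_matrix_def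
          sum_distrib_left mult_ac)
    also have "\<dots> = (\<Sum>y\<in>B j. \<Sum>x\<in>B i. \<mu> $ x * P $ x $ y / mass \<mu> (B i))"
      by (simp only: Indicator_Function.sum_indicator_mult[OF finite] Int_UNIV_left flip: sum_distrib_left)
    also have "\<dots> = (\<Sum>x\<in>B i. \<Sum>y\<in>B j. \<mu> $ x * P $ x $ y / mass \<mu> (B i))"
      by (rule sum.swap)
    also have "\<dots> = projection_chain \<mu> B P $ i $ j"
      by (simp add: projection_chain_def sum_divide_distrib)
    finally show ?thesis .
  qed
  then show ?thesis
    by (simp add: vec_eq_iff)
qed

text \<open>The double sum factors into two block masses, one of which cancels. With the
  factorization above, this carries invariance from points to blocks.\<close>

lemma projection_chain_constant_rows:
  "projection_chain \<mu> B (constant_rows \<mu>) = constant_rows (projected_measure \<mu> B)"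
proof -
  have "(\<Sum>x\<in>B i. \<Sum>y\<in>B j. \<mu> $ x * \<mu> $ y) = mass \<mu> (B i) * mass \<mu> (B j)" for i j
    by (simp add: mass_def sum_product)
  moreover have "mass \<mu> (B i) \<noteq> 0" for i
    using mass_pos[of i] by simp
  ultimately show ?thesis
    by (simp add: projection_chain_def constant_rows_def projected_measure_def vec_eq_iff)
qed

section \<open>Self-adjointness and fixed constant rows for both kernels\<close>

lemma weighted_adjoint_gibbs_kernel: "weighted_adjoint \<mu> (gibbs_kernel \<mu> B) = gibbs_kernel \<mu> B"
  unfolding weighted_adjoint_self_iff[OF \<mu>]
proof (intro allI)
  fix x y
  obtain i where i: "x \<in> B i"
    by (rule obtain_block)
  obtain j where j: "y \<in> B j"
    by (rule obtain_block)
  show "\<mu> $ x * gibbs_kernel \<mu> B $ x $ y = \<mu> $ y * gibbs_kernel \<mu> B $ y $ x"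
    by (simp add: gibbs_kernel_def block_of_eq[OF i] block_of_eq[OF j] mem_block_iff[OF i]
        mem_block_iff[OF j])
qed

lemma gibbs_kernel_mul_constant_rows:
  "gibbs_kernel \<mu> B ** constant_rows \<mu> = constant_rows \<mu>"
  unfolding mul_constant_rows_eq_iff[OF \<mu>]
proof
  fix x
  obtain i where i: "x \<in> B i"
    by (rule obtain_block)
  have "(\<Sum>y\<in>UNIV. gibbs_kernel \<mu> B $ x $ y)
      = (\<Sum>y\<in>UNIV. indicator (B i) y * \<mu> $ y) / mass \<mu> (B i)"
    unfolding sum_divide_distrib
    by (intro sum.cong) (auto simp: gibbs_kernel_def block_of_eq[OF i])
  also have "\<dots> = 1"
    using mass_pos[of i] by (simp only: Indicator_Function.sum_indicator_mult[OF finite] Int_UNIV_left flip: mass_def) simp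
  finally show "(\<Sum>y\<in>UNIV. gibbs_kernel \<mu> B $ x $ y) = 1" .
qed

text \<open>After the block masses cancel, detailed balance says that the flow from
  \<open>B i\<close> to \<open>B j\<close> equals the reverse flow, which is detailed balance for
  \<open>P\<close> summed over both blocks.\<close>

lemma weighted_adjoint_projection_chain:
  assumes "weighted_adjoint \<mu> P = P"
  shows "weighted_adjoint (projected_measure \<mu> B) (projection_chain \<mu> B P) = projection_chain \<mu> B P"
  unfolding weighted_adjoint_self_iff[OF positive_prob_projected_measure]
proof (intro allI)
  fix i j
  have "mass \<mu> (B i) \<noteq> 0" for i
    using mass_pos[of i] by simp
  moreover have "(\<Sum>x\<in>B i. \<Sum>y\<in>B j. \<mu> $ x * P $ x $ y) = (\<Sum>y\<in>B j. \<Sum>x\<in>B i. \<mu> $ y * P $ y $ x)"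
  proof -
    have "\<mu> $ x * P $ x $ y = \<mu> $ y * P $ y $ x" for x y
      using assms unfolding weighted_adjoint_self_iff[OF \<mu>] by blast
    then have "(\<Sum>x\<in>B i. \<Sum>y\<in>B j. \<mu> $ x * P $ x $ y) = (\<Sum>x\<in>B i. \<Sum>y\<in>B j. \<mu> $ y * P $ y $ x)"
      by (intro sum.cong refl)
    also have "\<dots> = (\<Sum>y\<in>B j. \<Sum>x\<in>B i. \<mu> $ y * P $ y $ x)"
      by (rule sum.swap)
    finally show ?thesis .
  qed
  ultimately show "projected_measure \<mu> B $ i * projection_chain \<mu> B P $ i $ j
      = projected_measure \<mu> B $ j * projection_chain \<mu> B P $ j $ i"
    by (simp add: projected_measure_def projection_chain_def)
qed

lemma projection_chain_mul_constant_rows: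
  assumes "P ** constant_rows \<mu> = constant_rows \<mu>"
  shows "projection_chain \<mu> B P ** constant_rows (projected_measure \<mu> B)
      = constant_rows (projected_measure \<mu> B)"
proof -
  let ?A = "membership_matrix B" and ?C = "conditional_matrix \<mu> B" and ?K = "constant_rows \<mu>"
  \<comment> \<open>Regrouping exposes \<open>?A ** ?C\<close>, the Gibbs kernel, which fixes
    \<open>?K\<close> before \<open>P\<close> does.\<close>
  have "(?C ** P ** ?A) ** (?C ** ?K ** ?A) = ?C ** (P ** ((?A ** ?C) ** ?K)) ** ?A"
    by (simp add: matrix_mul_assoc)
  also have "\<dots> = ?C ** ?K ** ?A"
    by (simp add: assms gibbs_kernel_mul_constant_rows flip: gibbs_kernel_factorization)
  finally show ?thesis
    by (simp add: projection_chain_factorization flip: projection_chain_constant_rows)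
qed

section \<open>Powers of the sandwich and their traces\<close>

text \<open>Between consecutive factors an inner \<open>C A\<close> cancels to the identity. The
  exponent 0 is excluded: there the left side is the identity and the right side is the Gibbs
  kernel.\<close>

lemma matrix_pow_gibbs_sandwich:
  assumes "m \<ge> 1"
  shows "matrix_pow (gibbs_kernel \<mu> B ** P ** gibbs_kernel \<mu> B) m
      = membership_matrix B ** matrix_pow (projection_chain \<mu> B P) m ** conditional_matrix \<mu> B"
  using assms
proof (induction m rule: nat_induct_at_least)
  case base
  show ?case
    by (simp add: gibbs_kernel_factorization projection_chain_factorization matrix_mul_assoc)
next
  case (Suc m)
  let ?A = "membership_matrix B" and ?C = "conditional_matrix \<mu> B" and ?Q = "projection_chain \<mu> B P"
  have "gibbs_kernel \<mu> B ** P ** gibbs_kernel \<mu> B = ?A ** ?Q ** ?C"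
    by (simp add: gibbs_kernel_factorization projection_chain_factorization matrix_mul_assoc)
  then have "matrix_pow (gibbs_kernel \<mu> B ** P ** gibbs_kernel \<mu> B) (Suc m)
      = ?A ** ?Q ** (?C ** ?A) ** matrix_pow ?Q m ** ?C"
    unfolding matrix_pow.simps Suc.IH by (simp add: matrix_mul_assoc)
  then show ?case
    by (simp add: conditional_mul_membership matrix_mul_assoc)
qed

lemma trace_matrix_pow_gibbs_sandwich:
  assumes "m \<ge> 1"
  shows "trace (matrix_pow (gibbs_kernel \<mu> B ** P ** gibbs_kernel \<mu> B) m)
      = trace (matrix_pow (projection_chain \<mu> B P) m)"
  unfolding matrix_pow_gibbs_sandwich[OF assms]
  \<comment> \<open>Cyclicity brings \<open>conditional_matrix\<close> to the front, where it
    cancels against \<open>membership_matrix\<close>.\<close>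
  by (subst trace_mul_sym) (simp add: matrix_mul_assoc conditional_mul_membership)

end

theorem corollary4p4:
  fixes \<pi> :: "real^'n::finite"
    and P :: "real^'n^'n"
    and B :: "'k::finite \<Rightarrow> 'n set"
    and l :: nat
  assumes "positive_prob \<pi>"
    and "P \<in> reversible_kernels \<pi>"
    and "is_partition B"
    and "l \<ge> 1"
  defines "G \<equiv> gibbs_kernel \<pi> B"
    and "P_bar \<equiv> projection_chain \<pi> B P"
    and "\<pi>_bar \<equiv> projected_measure \<pi> B"
  shows "(frobenius_norm \<pi> (matrix_pow (G ** P ** G) l - constant_rows \<pi>))\<^sup>2
           = trace (matrix_pow (G ** P ** G) (2 * l)) - 1
       \<and> trace (matrix_pow (G ** P ** G) (2 * l)) - 1
           = trace (matrix_pow P_bar (2 * l)) - trace (constant_rows \<pi>_bar)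
       \<and> trace (matrix_pow P_bar (2 * l)) - trace (constant_rows \<pi>_bar)
           = (frobenius_norm \<pi>_bar (matrix_pow P_bar l - constant_rows \<pi>_bar))\<^sup>2"
proof -
  note \<mu> = assms(1) and B = assms(3)
  have P: "weighted_adjoint \<pi> P = P"
    using assms(2) by (simp add: weighted_adjoint_self_iff[OF \<mu>] reversible_kernels_def)
  have P_fix: "P ** constant_rows \<pi> = constant_rows \<pi>"
    using assms(2)
    by (simp add: mul_constant_rows_eq_iff[OF \<mu>] reversible_kernels_def transition_matrix_def)
  have \<mu>_bar: "positive_prob \<pi>_bar"
    unfolding \<pi>_bar_def by (rule positive_prob_projected_measure[OF \<mu> B])
  have G: "weighted_adjoint \<pi> G = G" and G_fix: "G ** constant_rows \<pi> = constant_rows \<pi>"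
    unfolding G_def
    by (rule weighted_adjoint_gibbs_kernel[OF \<mu> B] gibbs_kernel_mul_constant_rows[OF \<mu> B])+
  \<comment> \<open>The product is a palindrome of self-adjoint factors.\<close>
  have "weighted_adjoint \<pi> (G ** P ** G) = G ** P ** G"
    by (simp add: weighted_adjoint_mul[OF \<mu>] G P matrix_mul_assoc)
  moreover have "(G ** P ** G) ** constant_rows \<pi> = constant_rows \<pi>"
    by (simp add: G_fix P_fix flip: matrix_mul_assoc)
  ultimately have 1: "(frobenius_norm \<pi> (matrix_pow (G ** P ** G) l - constant_rows \<pi>))\<^sup>2
      = trace (matrix_pow (G ** P ** G) (2 * l)) - 1"
    by (rule frobenius_norm_matrix_pow_diff_constant_rows[OF \<mu>])
  \<comment> \<open>Here \<open>l \<ge> 1\<close> matters: at exponent 0 the traces would be the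
    numbers of points and of blocks.\<close>
  have 2: "trace (matrix_pow (G ** P ** G) (2 * l)) = trace (matrix_pow P_bar (2 * l))"
    unfolding G_def P_bar_def using assms(4)
    by (intro trace_matrix_pow_gibbs_sandwich[OF \<mu> B]) simp
  have 3: "(frobenius_norm \<pi>_bar (matrix_pow P_bar l - constant_rows \<pi>_bar))\<^sup>2
      = trace (matrix_pow P_bar (2 * l)) - 1"
    using \<mu>_bar weighted_adjoint_projection_chain[OF \<mu> B P]
      projection_chain_mul_constant_rows[OF \<mu> B P_fix]
    unfolding P_bar_def \<pi>_bar_def by (rule frobenius_norm_matrix_pow_diff_constant_rows)
  show ?thesis
    using 1 2 3 trace_constant_rows[OF \<mu>_bar] by simp
qed

end
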